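(* Let $V_1(x)=\frac12\omega_1^2x^2$ and $V_2(y)=\frac12\omega_2^2y^2$ with $\omega_1,\omega_2>0$ and $\Omega=\omega_1/\omega_2$ rational (so $V_1=\Omega^2V_2$), let $P\in\mathscr{R}$ have numerical data $(\bar x^{\varsigma_1\varsigma_2},\bar y^{\varsigma_1\varsigma_2})$, with $k^{\varsigma_1\varsigma_2}=k(\bar x^{\varsigma_1\varsigma_2},\bar y^{\varsigma_1\varsigma_2})$, and let $E>0$. Suppose that $I\in\mathcal{J}_E$ is an interval such that for every $\varsigma_1,\varsigma_2\in\{\pm\}$ there exists $1\le l^{\varsigma_1\varsigma_2}\le k^{\varsigma_1\varsigma_2}$ such that $$I\subset\bigcap_{\varsigma_1,\varsigma_2\in\{\pm\}}\big[E-V_2(y^{\varsigma_1\varsigma_2}_{l^{\varsigma_1\varsigma_2}}),\,V_1(x^{\varsigma_1\varsigma_2}_{l^{\varsigma_1\varsigma_2}})\big].$$ Then the flow $(\varphi^{P,E,E_1}_t)_{t\in\mathbb{R}}$ is completely periodic (all its orbits are periodic) for every $E_1\in I$.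
   Context: Polygons: $\Xi$ is the set of sequences $(\bar x,\bar y)=(x_i,y_i)_{i=1}^k$ of points of $\mathbb{R}^2_{>0}$ with $0<x_1<\dots<x_k$ and $0<y_k<\dots<y_1$; set $k(\bar x,\bar y)=k$. $P(\bar x,\bar y)$ is the staircase polygon with consecutive vertices $(0,0),(0,y_1),(x_1,y_1),(x_1,y_2),\dots,(x_{k-1},y_{k-1}),(x_{k-1},y_k),(x_k,y_k),(x_k,0)$. $P(\pm\bar x,\pm\bar y)$ denotes its image under the corresponding reflections in the coordinate axes. $\mathscr{R}$ is the set of polygons $P=P(\bar x^{++},\bar y^{++})\cup P(-\bar x^{-+},\bar y^{-+})\cup P(\bar x^{+-},-\bar y^{+-})\cup P(-\bar x^{--},-\bar y^{--})$ with $(\bar x^{\varsigma_1\varsigma_2},\bar y^{\varsigma_1\varsigma_2})\in\Xi$ such that $y_1^{++}=y_1^{-+}$, $y_1^{+-}=y_1^{--}$, $x^{++}_{k^{++}}=x^{+-}_{k^{+-}}$, $x^{-+}_{k^{-+}}=x^{--}_{k^{--}}$. $\mathcal{J}_E$ is the partition (into open intervals) of $[0,E]$ determined by the numbers $V_1(x_k^{\varsigma_1\varsigma_2})$ and $E-V_2(y_k^{\varsigma_1\varsigma_2})$ for all $\varsigma_1,\varsigma_2\in\{\pm\}$, $1\le k\le k^{\varsigma_1\varsigma_2}$ (i.e. the connected components of $(0,E)$ with these numbers removed). Impact flow: $S^P_{E,E_1}=\{(p_x,x,p_y,y)\in\mathbb{R}^4: \frac{p_x^2}{2}+V_1(x)=E_1,\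 \frac{p_y^2}{2}+V_2(y)=E-E_1,\ (x,y)\in P\}$. The particle moves according to $\dot x=p_x,\ \dot p_x=-V_1'(x),\ \dot y=p_y,\ \dot p_y=-V_2'(y)$ inside $P$ and reflects elastically from the boundary: at a vertical side $(p_x,x,p_y,y)$ jumps to $(-p_x,x,p_y,y)$, at a horizontal side to $(p_x,x,-p_y,y)$; an orbit that hits a corner of $P$ stops. The resulting flow on $S^P_{E,E_1}$ is $(\varphi^{P,E,E_1}_t)_{t\in\mathbb{R}}$. *)

theory Defs
  imports "HOL-Analysis.Analysis"
begin

section \<open>Staircase polygons\<close>

definition Xi :: "(real \<times> real) list set" where
  "Xi = {d. d \<noteq> [] \<and> (\<forall>(x, y) \<in> set d. 0 < x \<and> 0 < y)
           \<and> sorted_wrt (<) (map fst d) \<and> sorted_wrt (>) (map snd d)}"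

text \<open>The polygon with a given cyclic list of vertices is the closed region bounded by its sides.\<close>

definition polygon_sides :: "(real \<times> real) list \<Rightarrow> (real \<times> real) set" where
  "polygon_sides vs = (\<Union>i<length vs. closed_segment (vs ! i) (vs ! (Suc i mod length vs)))"

definition polygon_region :: "(real \<times> real) list \<Rightarrow> (real \<times> real) set" where
  "polygon_region vs = polygon_sides vs \<union> inside (polygon_sides vs)"

fun stairs :: "(real \<times> real) list \<Rightarrow> (real \<times> real) list" where
  "stairs [] = []"
| "stairs [(x, y)] = [(x, y), (x, 0)]"
| "stairs ((x, y) # (x', y') # d) = (x, y) # (x, y') # stairs ((x', y') # d)"

definition staircase_polygon :: "(real \<times> real) list \<Rightarrow> (real \<times> real) set" where
  "staircase_polygon d = polygon_region ((0, 0) # (0, snd (hd d)) # stairs d)"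

datatype sign = Plus | Minus

fun sign_val :: "sign \<Rightarrow> real" where
  "sign_val Plus = 1"
| "sign_val Minus = -1"

definition reflect :: "sign \<Rightarrow> sign \<Rightarrow> real \<times> real \<Rightarrow> real \<times> real" where
  "reflect s1 s2 = (\<lambda>(x, y). (sign_val s1 * x, sign_val s2 * y))"

text \<open>\<open>P\<close> is a polygon of the class \<open>\<R>\<close> with numerical data \<open>d\<close>; the list \<open>d s1 s2\<close>
  describes the part of \<open>P\<close> in the quadrant with signs \<open>s1\<close>, \<open>s2\<close>.\<close>

definition has_numerical_data ::
  "(real \<times> real) set \<Rightarrow> (sign \<Rightarrow> sign \<Rightarrow> (real \<times> real) list) \<Rightarrow> bool" where
  "has_numerical_data P d \<longleftrightarrow>
     (\<forall>s1 s2. d s1 s2 \<in> Xi) \<and>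
     snd (hd (d Plus Plus)) = snd (hd (d Minus Plus)) \<and>
     snd (hd (d Plus Minus)) = snd (hd (d Minus Minus)) \<and>
     fst (last (d Plus Plus)) = fst (last (d Plus Minus)) \<and>
     fst (last (d Minus Plus)) = fst (last (d Minus Minus)) \<and>
     P = (\<Union>s1. \<Union>s2. reflect s1 s2 ` staircase_polygon (d s1 s2))"

text \<open>The partition \<open>\<J>\<^sub>E\<close> of \<open>[0, E]\<close>.\<close>

definition energy_partition ::
  "(real \<Rightarrow> real) \<Rightarrow> (real \<Rightarrow> real) \<Rightarrow> (sign \<Rightarrow> sign \<Rightarrow> (real \<times> real) list) \<Rightarrow> real \<Rightarrow> real set set" where
  "energy_partition V1 V2 d E =
     components ({0<..<E} - (\<Union>s1. \<Union>s2. \<Union>(x, y) \<in> set (d s1 s2). {V1 x, E - V2 y}))"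

section \<open>The impact flow\<close>

text \<open>States are tuples \<open>(p\<^sub>x, x, p\<^sub>y, y)\<close>.\<close>

type_synonym state = "real \<times> real \<times> real \<times> real"

fun position :: "state \<Rightarrow> real \<times> real" where
  "position (px, x, py, y) = (x, y)"

fun flip_x :: "state \<Rightarrow> state" where
  "flip_x (px, x, py, y) = (- px, x, py, y)"

fun flip_y :: "state \<Rightarrow> state" where
  "flip_y (px, x, py, y) = (px, x, - py, y)"

fun hamilton_field :: "(real \<Rightarrow> real) \<Rightarrow> (real \<Rightarrow> real) \<Rightarrow> state \<Rightarrow> state" where
  "hamilton_field V1 V2 (px, x, py, y) = (- deriv V1 x, px, - deriv V2 y, py)"

definition level_set ::
  "(real \<Rightarrow> real) \<Rightarrow> (real \<Rightarrow> real) \<Rightarrow> (real \<times> real) set \<Rightarrow> real \<Rightarrow> real \<Rightarrow> state set" where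
  "level_set V1 V2 P E E1 =
     {(px, x, py, y). px\<^sup>2 / 2 + V1 x = E1 \<and> py\<^sup>2 / 2 + V2 y = E - E1 \<and> (x, y) \<in> P}"

text \<open>Boundary points near which the boundary is a vertical (horizontal) segment. The remaining
  boundary points are the corners; so the points where polygons of adjacent quadrants
  are glued along an axis are not corners.\<close>

definition vertical_side :: "(real \<times> real) set \<Rightarrow> (real \<times> real) set" where
  "vertical_side P = {q \<in> frontier P.
     \<exists>e>0. frontier P \<inter> ball q e = {p \<in> ball q e. fst p = fst q}}"

definition horizontal_side :: "(real \<times> real) set \<Rightarrow> (real \<times> real) set" where
  "horizontal_side P = {q \<in> frontier P.
     \<exists>e>0. frontier P \<inter> ball q e = {p \<in> ball q e. snd p = snd q}}"

definition corners :: "(real \<times> real) set \<Rightarrow> (real \<times> real) set" where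
  "corners P = frontier P - (vertical_side P \<union> horizontal_side P)"

text \<open>A motion \<open>g\<close> on an open time interval \<open>J\<close> containing 0. At an impact \<open>g t\<close> is the
  state after the reflection, and the left limit of \<open>g\<close> is the state before it. Impact times
  do not accumulate in \<open>J\<close>.\<close>

definition impact_motion ::
  "(real \<Rightarrow> real) \<Rightarrow> (real \<Rightarrow> real) \<Rightarrow> (real \<times> real) set \<Rightarrow> real set \<Rightarrow> (real \<Rightarrow> state) \<Rightarrow> bool" where
  "impact_motion V1 V2 P J g \<longleftrightarrow>
     open J \<and> is_interval J \<and> 0 \<in> J \<and>
     (\<forall>t\<in>J. position (g t) \<in> P - corners P) \<and>
     (\<forall>a b. {a..b} \<subseteq> J \<longrightarrow> finite {t \<in> {a..b}. position (g t) \<in> frontier P}) \<and>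
     (\<forall>t\<in>J. position (g t) \<in> interior P \<longrightarrow>
        (g has_vector_derivative hamilton_field V1 V2 (g t)) (at t)) \<and>
     (\<forall>t\<in>J. position (g t) \<in> vertical_side P \<longrightarrow>
        (g \<longlongrightarrow> flip_x (g t)) (at_left t) \<and> (g \<longlongrightarrow> g t) (at_right t)) \<and>
     (\<forall>t\<in>J. position (g t) \<in> horizontal_side P \<longrightarrow>
        (g \<longlongrightarrow> flip_y (g t)) (at_left t) \<and> (g \<longlongrightarrow> g t) (at_right t))"

text \<open>The orbit of \<open>s\<close>: a motion that cannot be continued in either time direction and
  that passes through \<open>s\<close> at time 0. Here \<open>s\<close> may also be a state
  just before an impact. An orbit that runs into a corner has \<open>J \<noteq> UNIV\<close>.\<close>

definition impact_orbit ::
  "(real \<Rightarrow> real) \<Rightarrow> (real \<Rightarrow> real) \<Rightarrow> (real \<times> real) set \<Rightarrow> state \<Rightarrow> real set \<Rightarrow> (real \<Rightarrow> state) \<Rightarrow> bool" where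
  "impact_orbit V1 V2 P s J g \<longleftrightarrow>
     impact_motion V1 V2 P J g \<and>
     (\<forall>J' g'. impact_motion V1 V2 P J' g' \<and> J \<subseteq> J' \<and> (\<forall>t\<in>J. g' t = g t) \<longrightarrow> J' = J) \<and>
     (g 0 = s \<or> (g \<longlongrightarrow> s) (at_left 0))"

text \<open>Every state of the level set has an orbit, which never stops and is periodic.\<close>

definition completely_periodic ::
  "(real \<Rightarrow> real) \<Rightarrow> (real \<Rightarrow> real) \<Rightarrow> (real \<times> real) set \<Rightarrow> real \<Rightarrow> real \<Rightarrow> bool" where
  "completely_periodic V1 V2 P E E1 \<longleftrightarrow>
     (\<forall>s \<in> level_set V1 V2 P E E1.
        (\<exists>J g. impact_orbit V1 V2 P s J g) \<and>
        (\<forall>J g. impact_orbit V1 V2 P s J g \<longrightarrow>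
           J = UNIV \<and> (\<exists>T>0. \<forall>t. g (t + T) = g t)))"

end

theory Submission
  imports Defs
begin

text \<open>Since \<open>I\<close> avoids the endpoints of the given intervals, at every energy \<open>E1 \<in> I\<close> the rectangle
  of positions with \<open>V1 x \<le> E1\<close> and \<open>V2 y \<le> E - E1\<close> lies in the interior of \<open>P\<close>. Hence no orbit
  meets the boundary, and the flow is a product of two harmonic oscillations with commensurable
  frequencies. That no other orbits exist is a connectedness argument: positions are continuous
  even across impacts, so an orbit can leave the harmonic motion neither by an impact
  nor in between.\<close>

section \<open>Staircase polygons contain their rectangles\<close>

text \<open>The open polygonal path, without the closing side of \<open>polygon_sides\<close>.
  Recursion on the vertex list lets it follow the recursion of \<open>stairs\<close>.\<close>

fun path_sides :: "(real \<times> real) list \<Rightarrow> (real \<times> real) set" where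
  "path_sides (p # q # r) = closed_segment p q \<union> path_sides (q # r)"
| "path_sides _ = {}"

lemma path_sides_nth:
  "p \<in> path_sides vs \<Longrightarrow> \<exists>i. Suc i < length vs \<and> p \<in> closed_segment (vs ! i) (vs ! Suc i)"
proof (induction vs rule: path_sides.induct)
  case (1 a b r)
  show ?case
  proof (cases "p \<in> closed_segment a b")
    case True
    then show ?thesis by (intro exI[of _ 0]) auto
  next
    case False
    with 1 obtain i where "Suc i < length (b # r)"
      "p \<in> closed_segment ((b # r) ! i) ((b # r) ! Suc i)"
      by auto
    then show ?thesis by (intro exI[of _ "Suc i"]) auto
  qed
qed auto

lemma path_sides_subset_polygon_sides: "path_sides vs \<subseteq> polygon_sides vs"
proof
  fix p assume "p \<in> path_sides vs"
  from path_sides_nth[OF this] obtain i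
    where i: "Suc i < length vs" "p \<in> closed_segment (vs ! i) (vs ! Suc i)" by blast
  then show "p \<in> polygon_sides vs"
    unfolding polygon_sides_def by (intro UN_I[of i]) auto
qed

lemma last_side_subset_polygon_sides:
  assumes "vs \<noteq> []"
  shows "closed_segment (last vs) (hd vs) \<subseteq> polygon_sides vs"
  unfolding polygon_sides_def using assms
  \<comment> \<open>The successor of the last index is 0 modulo the length, so this index gives the
    closing side.\<close>
  by (intro SUP_upper2[of "length vs - 1"]) (auto simp: last_conv_nth hd_conv_nth)

lemma in_vertical_segment:
  fixes v c d x :: real
  assumes "c \<le> v" "v \<le> d"
  shows "(x, v) \<in> closed_segment (x, c) (x, d)" "(x, v) \<in> closed_segment (x, d) (x, c)"
  using assms by (auto simp: closed_segment_same_fst closed_segment_eq_real_ivl)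

lemma in_horizontal_segment:
  fixes u a b y :: real
  assumes "a \<le> u" "u \<le> b"
  shows "(u, y) \<in> closed_segment (a, y) (b, y)" "(u, y) \<in> closed_segment (b, y) (a, y)"
  using assms by (auto simp: closed_segment_same_snd closed_segment_eq_real_ivl)

lemma stairs_not_Nil: "d \<noteq> [] \<Longrightarrow> stairs d \<noteq> []"
  by (cases d rule: stairs.cases) auto

lemma last_stairs: "d \<noteq> [] \<Longrightarrow> last (stairs d) = (fst (last d), 0)"
  by (induction d rule: stairs.induct) (auto simp: stairs_not_Nil)

text \<open>The last two hypotheses place \<open>(u, v)\<close> under some outer corner but strictly
  under none, hence on the staircase. The starting abscissa \<open>a\<close> is arbitrary for the
  induction: once the first step is removed, the remaining path starts at abscissa \<open>x\<close>
  instead of 0.\<close>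

lemma upper_boundary_in_path_sides:
  assumes "d \<noteq> []" "sorted_wrt (<) (map fst d)" "sorted_wrt (>) (map snd d)"
    and "a \<le> u" "0 \<le> v"
    and "\<exists>(x, y) \<in> set d. u \<le> x \<and> v \<le> y"
    and "\<forall>(x, y) \<in> set d. x \<le> u \<or> y \<le> v"
  shows "(u, v) \<in> path_sides ((a, snd (hd d)) # stairs d)"
  using assms
proof (induction d arbitrary: a rule: stairs.induct)
  case (2 x y)
  then consider "v = y" "u \<le> x" | "u = x" "v \<le> y" by auto
  then show ?case
    using 2 by cases (auto intro: in_horizontal_segment in_vertical_segment)
next
  case (3 x y x' y' d)
  from "3.prems"(3,6) have vy: "v \<le> y" by fastforce
  show ?case
  proof (cases "u \<le> x")
    case True
    \<comment> \<open>If \<open>v < y\<close>, then \<open>x \<le> u\<close>, so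
      \<open>u = x < x'\<close>. The second corner then forces \<open>y' \<le> v\<close>, which puts
      the point on the vertical side from \<open>(x, y)\<close> to \<open>(x, y')\<close>.\<close>
    then consider "v = y" | "u = x" "y' \<le> v"
      using "3.prems"(2,7) vy by fastforce
    then show ?thesis
      using True vy "3.prems" by cases (auto intro: in_horizontal_segment in_vertical_segment)
  next
    case False
    then have "(u, v) \<in> path_sides ((x, snd (hd ((x', y') # d))) # stairs ((x', y') # d))"
      using "3.prems" by (intro "3.IH") auto
    then show ?thesis by simp
  qed
qed simp

lemma Xi_fst_le_last:
  assumes "d \<in> Xi" "(x, y) \<in> set d"
  shows "x \<le> fst (last d)"
  using assms unfolding Xi_def
  by (cases d rule: rev_cases) (force simp: sorted_wrt_append)+

lemma Xi_snd_le_hd: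
  assumes "d \<in> Xi" "(x, y) \<in> set d"
  shows "y \<le> snd (hd d)"
  using assms unfolding Xi_def by (cases d) force+

text \<open>A frontier point of the open set \<open>U\<close> lies in one of the closed rectangles
  but in none of the open ones. On the axes it belongs to the first side or to the closing side,
  elsewhere to the staircase.\<close>

lemma frontier_rectangles_subset_sides:
  assumes d: "d \<in> Xi"
  defines "U \<equiv> \<Union>(x, y) \<in> set d. {0<..<x} \<times> {0<..<y}"
  shows "frontier U \<subseteq> polygon_sides ((0, 0) # (0, snd (hd d)) # stairs d)" (is "_ \<subseteq> polygon_sides ?vs")
proof
  fix p assume p: "p \<in> frontier U"
  obtain u v where uv: "p = (u, v)" by force
  have "open U" unfolding U_def by (auto intro!: open_UN open_Times)
  have "closed (\<Union>(x, y) \<in> set d. {0..x} \<times> {0..y})"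
    by (auto intro!: closed_UN closed_Times)
  then have "closure U \<subseteq> (\<Union>(x, y) \<in> set d. {0..x} \<times> {0..y})"
    unfolding U_def by (rule closure_minimal[rotated]) (rule UN_mono, auto)
  with p uv \<open>open U\<close> have notU: "(u, v) \<notin> U"
    and "(u, v) \<in> (\<Union>(x, y) \<in> set d. {0..x} \<times> {0..y})"
    by (auto simp: frontier_def interior_open)
  then obtain x y where xy: "(x, y) \<in> set d" "0 \<le> u" "u \<le> x" "0 \<le> v" "v \<le> y" by auto
  have dn: "d \<noteq> []" using d by (auto simp: Xi_def)
  consider "u = 0" | "v = 0" | "u > 0" "v > 0" using xy by linarith
  then show "p \<in> polygon_sides ?vs"
  proof cases
    case 1
    then have "p \<in> path_sides ?vs"
      using xy Xi_snd_le_hd[OF d xy(1)] by (auto simp: uv intro: in_vertical_segment)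
    then show ?thesis using path_sides_subset_polygon_sides by blast
  next
    case 2
    then have "p \<in> closed_segment (last ?vs) (hd ?vs)"
      using xy Xi_fst_le_last[OF d xy(1)] dn
      by (auto simp: uv last_stairs stairs_not_Nil intro: in_horizontal_segment)
    then show ?thesis using last_side_subset_polygon_sides[of ?vs] by blast
  next
    case 3
    have "(u, v) \<in> path_sides ((0, snd (hd d)) # stairs d)"
    proof (rule upper_boundary_in_path_sides[OF dn])
      show "\<forall>(x, y) \<in> set d. x \<le> u \<or> y \<le> v"
        using notU 3 by (force simp: U_def)
    qed (use d xy in \<open>auto simp: Xi_def\<close>)
    then have "p \<in> path_sides ?vs" by (simp add: uv)
    then show ?thesis using path_sides_subset_polygon_sides by blast
  qed
qed

text \<open>For a point of \<open>U\<close> off the sides, its component in the complement of the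
  sides avoids \<open>frontier U\<close>. Being connected, it stays within the bounded set
  \<open>U\<close>, so the point is inside the sides.\<close>

lemma polygon_region_superset:
  assumes "bounded U" "frontier U \<subseteq> polygon_sides vs"
  shows "U \<subseteq> polygon_region vs"
proof
  fix p assume p: "p \<in> U"
  let ?S = "polygon_sides vs"
  let ?C = "connected_component_set (- ?S) p"
  show "p \<in> polygon_region vs"
  proof (cases "p \<in> ?S")
    case False
    then have pC: "p \<in> ?C" by simp
    have "?C \<inter> frontier U = {}"
      using assms(2) connected_component_subset[of "- ?S" p] by blast
    then have "?C \<subseteq> U"
      using connected_Int_frontier[of ?C U] p pC by blast
    then have "bounded ?C" using assms(1) bounded_subset by blast
    then show ?thesis using False by (simp add: polygon_region_def inside_def)
  qed (simp add: polygon_region_def)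
qed

text \<open>The rectangle includes its edges on the axes, so that the four reflected copies leave no
  gap there. Those edges lie on sides of the polygon; all other points lie in the union of open
  rectangles enclosed by the sides.\<close>

lemma rectangle_subset_staircase_polygon:
  assumes d: "d \<in> Xi" and xy: "(x, y) \<in> set d"
  shows "{0..<x} \<times> {0..<y} \<subseteq> staircase_polygon d"
proof clarify
  fix u v :: real assume uv: "u \<in> {0..<x}" "v \<in> {0..<y}"
  define U where "U = (\<Union>(x, y) \<in> set d. {0<..<x} \<times> {0<..<y :: real})"
  let ?vs = "(0, 0) # (0, snd (hd d)) # stairs d"
  have dn: "d \<noteq> []" using d by (auto simp: Xi_def)
  have U: "U \<subseteq> polygon_region ?vs"
  proof (rule polygon_region_superset)
    show "bounded U" unfolding U_def
      by (auto intro!: bounded_UN bounded_Times simp flip: box_real)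
    show "frontier U \<subseteq> polygon_sides ?vs"
      unfolding U_def by (rule frontier_rectangles_subset_sides[OF d])
  qed
  consider "u = 0" | "v = 0" | "u > 0" "v > 0" using uv by force
  then show "(u, v) \<in> staircase_polygon d"
  proof cases
    case 1
    then have "(u, v) \<in> path_sides ?vs"
      using uv Xi_snd_le_hd[OF d xy(1)] by (auto intro: in_vertical_segment)
    then show ?thesis using path_sides_subset_polygon_sides[of ?vs]
      unfolding staircase_polygon_def polygon_region_def by blast
  next
    case 2
    then have "(u, v) \<in> closed_segment (last ?vs) (hd ?vs)"
      using uv Xi_fst_le_last[OF d xy(1)] dn
      by (auto simp: last_stairs stairs_not_Nil intro: in_horizontal_segment)
    then show ?thesis using last_side_subset_polygon_sides[of ?vs]
      unfolding staircase_polygon_def polygon_region_def by blast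
  next
    case 3
    then have "(u, v) \<in> U" using uv xy by (force simp: U_def)
    then show ?thesis using U by (auto simp: staircase_polygon_def)
  qed
qed

lemma all_sign: "(\<forall>s. Q s) \<longleftrightarrow> Q Plus \<and> Q Minus"
  by (metis sign.exhaust)

text \<open>One corner is chosen in each quadrant. The rectangle \<open>W\<close>, centred at the
  origin and bounded by the smallest of these coordinates, is open, and each of its points is the
  reflection of a point in a rectangle under the corner chosen for its own quadrant.\<close>

lemma in_interior_polygon:
  fixes X Y :: "sign \<Rightarrow> sign \<Rightarrow> real"
  assumes P: "has_numerical_data P d"
    and XY: "\<And>s1 s2. (X s1 s2, Y s1 s2) \<in> set (d s1 s2)"
    and uv: "\<And>s1 s2. \<bar>u\<bar> < X s1 s2 \<and> \<bar>v\<bar> < Y s1 s2"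
  shows "(u, v) \<in> interior P"
proof -
  define W where "W = {p. \<forall>s1 s2. \<bar>fst p\<bar> < X s1 s2 \<and> \<bar>snd p\<bar> < Y s1 s2}"
  \<comment> \<open>\<open>all_sign\<close> turns the quantifiers into a finite conjunction of
    strict inequalities between continuous functions.\<close>
  have "open W" unfolding W_def all_sign
    by (intro open_Collect_conj open_Collect_less continuous_intros)
  moreover have "W \<subseteq> P"
  proof
    fix p assume p: "p \<in> W"
    define s1 s2 where "s1 = (if fst p \<ge> 0 then Plus else Minus)"
      and "s2 = (if snd p \<ge> 0 then Plus else Minus)"
    have "d s1 s2 \<in> Xi" using P by (simp add: has_numerical_data_def)
    moreover have "(\<bar>fst p\<bar>, \<bar>snd p\<bar>) \<in> {0..<X s1 s2} \<times> {0..<Y s1 s2}"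
      using p by (auto simp: W_def)
    ultimately have "(\<bar>fst p\<bar>, \<bar>snd p\<bar>) \<in> staircase_polygon (d s1 s2)"
      using rectangle_subset_staircase_polygon XY by blast
    moreover have "p = reflect s1 s2 (\<bar>fst p\<bar>, \<bar>snd p\<bar>)"
      by (auto simp: reflect_def s1_def s2_def prod_eq_iff)
    ultimately show "p \<in> P" using P unfolding has_numerical_data_def by blast
  qed
  moreover have "(u, v) \<in> W" using uv by (simp add: W_def)
  ultimately show ?thesis by (meson interiorI)
qed

section \<open>Harmonic motions\<close>

text \<open>In the coordinates \<open>(p, \<omega> * q)\<close> each degree of freedom is a rotation
  by the angle \<open>\<omega> * t\<close>.\<close>

fun harmonic_motion :: "real \<Rightarrow> real \<Rightarrow> state \<Rightarrow> real \<Rightarrow> state" where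
  "harmonic_motion \<omega>1 \<omega>2 (px, x, py, y) t =
     (px * cos (\<omega>1 * t) - \<omega>1 * x * sin (\<omega>1 * t), x * cos (\<omega>1 * t) + px / \<omega>1 * sin (\<omega>1 * t),
      py * cos (\<omega>2 * t) - \<omega>2 * y * sin (\<omega>2 * t), y * cos (\<omega>2 * t) + py / \<omega>2 * sin (\<omega>2 * t))"

lemma harmonic_motion_0 [simp]: "harmonic_motion \<omega>1 \<omega>2 s 0 = s"
  by (cases s) simp

lemma deriv_harmonic_potential: "deriv (\<lambda>x::real. 1 / 2 * \<omega>\<^sup>2 * x\<^sup>2) x = \<omega>\<^sup>2 * x"
  by (rule DERIV_imp_deriv) (auto intro!: derivative_eq_intros)

abbreviation harmonic_field :: "real \<Rightarrow> real \<Rightarrow> state \<Rightarrow> state" where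
  "harmonic_field \<omega>1 \<omega>2 \<equiv> hamilton_field (\<lambda>x. 1 / 2 * \<omega>1\<^sup>2 * x\<^sup>2) (\<lambda>y. 1 / 2 * \<omega>2\<^sup>2 * y\<^sup>2)"

text \<open>Written with projections, the field is visibly linear in the state.\<close>

lemma harmonic_field_eq:
  "harmonic_field \<omega>1 \<omega>2 s =
    (- \<omega>1\<^sup>2 * fst (snd s), fst s, - \<omega>2\<^sup>2 * snd (snd (snd s)), fst (snd (snd s)))"
  by (cases s) (simp only: hamilton_field.simps deriv_harmonic_potential, simp)

lemma harmonic_motion_derivative:
  assumes "\<omega>1 \<noteq> 0" "\<omega>2 \<noteq> 0"
  shows "(harmonic_motion \<omega>1 \<omega>2 s has_vector_derivative
           harmonic_field \<omega>1 \<omega>2 (harmonic_motion \<omega>1 \<omega>2 s t)) (at t)"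
proof (cases s)
  case (fields px x py y)
  \<comment> \<open>The defining equation rewrites only full applications, so the motion is first
    expanded as a function of time.\<close>
  have "harmonic_motion \<omega>1 \<omega>2 s = (\<lambda>t.
     (px * cos (\<omega>1 * t) - \<omega>1 * x * sin (\<omega>1 * t), x * cos (\<omega>1 * t) + px / \<omega>1 * sin (\<omega>1 * t),
      py * cos (\<omega>2 * t) - \<omega>2 * y * sin (\<omega>2 * t), y * cos (\<omega>2 * t) + py / \<omega>2 * sin (\<omega>2 * t)))"
    by (auto simp: fields)
  then show ?thesis
    using assms unfolding fields harmonic_field_eq
    by (auto simp: algebra_simps power2_eq_square
        simp flip: has_real_derivative_iff_has_vector_derivative
        intro!: has_vector_derivative_Pair derivative_eq_intros)
qed

text \<open>Rotations in the coordinates \<open>(p, \<omega> * q)\<close> preserve the sum of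
  squares, which is twice the energy of that degree of freedom.\<close>

lemma harmonic_motion_level_set:
  assumes "\<omega>1 \<noteq> 0" "\<omega>2 \<noteq> 0" and "harmonic_motion \<omega>1 \<omega>2 (px, x, py, y) t = (px', x', py', y')"
  shows "px'\<^sup>2 / 2 + 1 / 2 * \<omega>1\<^sup>2 * x'\<^sup>2 = px\<^sup>2 / 2 + 1 / 2 * \<omega>1\<^sup>2 * x\<^sup>2"
    and "py'\<^sup>2 / 2 + 1 / 2 * \<omega>2\<^sup>2 * y'\<^sup>2 = py\<^sup>2 / 2 + 1 / 2 * \<omega>2\<^sup>2 * y\<^sup>2"
proof -
  have energy: "(p * c - w * q * s)\<^sup>2 / 2 + 1 / 2 * w\<^sup>2 * (q * c + p / w * s)\<^sup>2
      = p\<^sup>2 / 2 + 1 / 2 * w\<^sup>2 * q\<^sup>2"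
    if "s\<^sup>2 + c\<^sup>2 = 1" "w \<noteq> 0" for p q w s c :: real
  proof -
    have "w\<^sup>2 * (q * c + p / w * s)\<^sup>2 = (w * q * c + p * s)\<^sup>2"
      using that(2) by (simp add: field_simps flip: power_mult_distrib)
    moreover have "(p * c - w * q * s)\<^sup>2 + (w * q * c + p * s)\<^sup>2 = (p\<^sup>2 + w\<^sup>2 * q\<^sup>2) * (s\<^sup>2 + c\<^sup>2)"
      by (simp add: algebra_simps power2_eq_square)
    ultimately show ?thesis using that(1) by simp
  qed
  show "px'\<^sup>2 / 2 + 1 / 2 * \<omega>1\<^sup>2 * x'\<^sup>2 = px\<^sup>2 / 2 + 1 / 2 * \<omega>1\<^sup>2 * x\<^sup>2"
    using assms(3) energy[OF sin_cos_squared_add assms(1)] by auto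
  show "py'\<^sup>2 / 2 + 1 / 2 * \<omega>2\<^sup>2 * y'\<^sup>2 = py\<^sup>2 / 2 + 1 / 2 * \<omega>2\<^sup>2 * y\<^sup>2"
    using assms(3) energy[OF sin_cos_squared_add assms(2)] by auto
qed

lemma harmonic_motion_periodic:
  assumes "\<omega>1 > 0" "\<omega>2 > 0" "\<omega>1 / \<omega>2 \<in> \<rat>"
  shows "\<exists>T>0. \<forall>t. harmonic_motion \<omega>1 \<omega>2 s (t + T) = harmonic_motion \<omega>1 \<omega>2 s t"
proof -
  obtain m n :: nat where mn: "n \<noteq> 0" "\<bar>\<omega>1 / \<omega>2\<bar> = m / n"
    using assms(3) Rats_abs_nat_div_natE by metis
  \<comment> \<open>With frequency ratio \<open>m / n\<close>, the two phases advance over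
    \<open>T\<close> by \<open>m\<close> and \<open>n\<close> full turns. The same \<open>T\<close>
    serves every initial state.\<close>
  define T where "T = 2 * real n * pi / \<omega>2"
  have w2: "\<omega>2 * T = 2 * real n * pi" using assms by (simp add: T_def)
  have "\<omega>1 = m / n * \<omega>2" using assms mn by (simp add: field_simps)
  then have w1: "\<omega>1 * T = 2 * real m * pi" using assms mn by (simp add: T_def)
  have per: "cos (w * (t + T)) = cos (w * t)" "sin (w * (t + T)) = sin (w * t)"
    if "w * T = 2 * real k * pi" for w t k
    using that by (simp_all add: distrib_left cos_add sin_add)
  have "harmonic_motion \<omega>1 \<omega>2 s (t + T) = harmonic_motion \<omega>1 \<omega>2 s t" for t
    by (cases s) (simp add: per[OF w1] per[OF w2])
  moreover have "T > 0" using assms mn by (simp add: T_def)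
  ultimately show ?thesis by blast
qed

text \<open>The energy \<open>p\<^sup>2 + w\<^sup>2 * q\<^sup>2\<close> has derivative zero, so it
  is constant on the convex set \<open>B\<close>. It vanishes at \<open>t0\<close>, and both of its
  terms are nonnegative.\<close>

lemma oscillator_zero_unique:
  fixes p q :: "real \<Rightarrow> real"
  assumes "convex B" "w \<noteq> 0"
    and p: "\<And>t. t \<in> B \<Longrightarrow> (p has_real_derivative - w\<^sup>2 * q t) (at t)"
    and q: "\<And>t. t \<in> B \<Longrightarrow> (q has_real_derivative p t) (at t)"
    and t0: "t0 \<in> B" "p t0 = 0" "q t0 = 0" and t: "t \<in> B"
  shows "p t = 0 \<and> q t = 0"
proof -
  let ?e = "\<lambda>t. (p t)\<^sup>2 + w\<^sup>2 * (q t)\<^sup>2"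
  have "(?e has_real_derivative 0) (at t within B)" if "t \<in> B" for t
    by (rule has_field_derivative_at_within)
      (auto intro!: derivative_eq_intros p q that simp: algebra_simps)
  then have "\<exists>c. \<forall>t\<in>B. ?e t = c"
    using has_field_derivative_zero_constant[OF \<open>convex B\<close>] by blast
  with t t0 have "?e t = 0" by (metis add.right_neutral mult_zero_right power_zero_numeral)
  then have "(p t)\<^sup>2 = 0" "w\<^sup>2 * (q t)\<^sup>2 = 0"
    using zero_le_power2[of "p t"] zero_le_mult_iff[of "w\<^sup>2" "(q t)\<^sup>2"] by (smt (verit) zero_le_power2)+
  then show ?thesis using assms(2) by simp
qed

text \<open>By linearity the difference of two solutions is again a solution. It splits into two
  independent oscillators, each at rest in the origin at time \<open>t0\<close>.\<close>

lemma harmonic_field_unique: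
  assumes "convex B" "\<omega>1 \<noteq> 0" "\<omega>2 \<noteq> 0"
    and g: "\<And>t. t \<in> B \<Longrightarrow> (g has_vector_derivative harmonic_field \<omega>1 \<omega>2 (g t)) (at t)"
    and h: "\<And>t. t \<in> B \<Longrightarrow> (h has_vector_derivative harmonic_field \<omega>1 \<omega>2 (h t)) (at t)"
    and t0: "t0 \<in> B" "g t0 = h t0" and t: "t \<in> B"
  shows "g t = h t"
proof -
  define f where "f t = g t - h t" for t
  have f: "(f has_vector_derivative harmonic_field \<omega>1 \<omega>2 (f t)) (at t)" if "t \<in> B" for t
  proof -
    have "harmonic_field \<omega>1 \<omega>2 (f t) = harmonic_field \<omega>1 \<omega>2 (g t) - harmonic_field \<omega>1 \<omega>2 (h t)"
      unfolding harmonic_field_eq by (simp add: f_def algebra_simps)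
    then show ?thesis
      unfolding f_def[abs_def] using has_vector_derivative_diff[OF g[OF that] h[OF that]] by simp
  qed
  have component: "((\<lambda>t. L (f t)) has_real_derivative L (harmonic_field \<omega>1 \<omega>2 (f t))) (at t)"
    if "t \<in> B" "bounded_linear L" for t L
    using bounded_linear.has_vector_derivative[OF that(2) f[OF that(1)]]
    by (simp add: has_real_derivative_iff_has_vector_derivative)
  \<comment> \<open>The four projections, in the order \<open>p\<^sub>x\<close>, \<open>x\<close>,
    \<open>p\<^sub>y\<close>, \<open>y\<close>.\<close>
  note component[OF _ bounded_linear_fst]
    component[OF _ bounded_linear_fst_comp[OF bounded_linear_snd]]
    component[OF _ bounded_linear_fst_comp[OF bounded_linear_snd_comp[OF bounded_linear_snd]]]
    component[OF _ bounded_linear_snd_comp[OF bounded_linear_snd_comp[OF bounded_linear_snd]]]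
  note components = this[unfolded harmonic_field_eq fst_conv snd_conv]
  have f0: "f t0 = 0" using t0(2) by (simp add: f_def)
  have "fst (f t) = 0 \<and> fst (snd (f t)) = 0"
    by (rule oscillator_zero_unique[OF assms(1,2) _ _ t0(1) _ _ t])
      (use components(1,2) f0 in simp_all)
  moreover have "fst (snd (snd (f t))) = 0 \<and> snd (snd (snd (f t))) = 0"
    by (rule oscillator_zero_unique[OF assms(1,3) _ _ t0(1) _ _ t])
      (use components(3,4) f0 in simp_all)
  ultimately show ?thesis by (simp add: f_def prod_eq_iff)
qed

section \<open>Motions without impacts\<close>

lemma position_eq: "position s = (fst (snd s), snd (snd (snd s)))"
  by (cases s) simp

lemma tendsto_position:
  "(g \<longlongrightarrow> s) F \<Longrightarrow> ((\<lambda>t. position (g t)) \<longlongrightarrow> position s) F"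
  unfolding position_eq by (intro tendsto_intros)

lemma position_flip [simp]: "position (flip_x s) = position s" "position (flip_y s) = position s"
  by (cases s; simp)+

text \<open>A motion avoids corners, so a position off the interior lies on a side. Both kinds of
  side share one case, with \<open>f\<close> the corresponding reflection.\<close>

lemma impact_motion_cases:
  assumes "impact_motion V1 V2 P J g" "t \<in> J"
  obtains (interior) "position (g t) \<in> interior P"
      "(g has_vector_derivative hamilton_field V1 V2 (g t)) (at t)"
  | (impact) f where "position (g t) \<in> frontier P" "f = flip_x \<or> f = flip_y"
      "(g \<longlongrightarrow> f (g t)) (at_left t)" "(g \<longlongrightarrow> g t) (at_right t)"
proof -
  have pos: "position (g t) \<in> P - corners P" using assms by (simp add: impact_motion_def)
  show thesis
  proof (cases "position (g t) \<in> interior P")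
    case True
    then show thesis using assms that(1) by (simp add: impact_motion_def)
  next
    case False
    with pos have fr: "position (g t) \<in> frontier P"
      using closure_subset by (auto simp: frontier_def)
    with pos have "position (g t) \<in> vertical_side P \<or> position (g t) \<in> horizontal_side P"
      by (auto simp: corners_def)
    then show thesis using that(2)[OF fr] assms unfolding impact_motion_def by metis
  qed
qed

text \<open>Reflections change only momenta, so at an impact both one-sided limits of the position
  agree with its value.\<close>

lemma impact_motion_position_continuous:
  assumes "impact_motion V1 V2 P J g" "t \<in> J"
  shows "isCont (\<lambda>t. position (g t)) t"
  using assms
proof (cases rule: impact_motion_cases)
  case interior
  have "isCont g t" by (rule has_vector_derivative_continuous[OF interior(2)])
  then show ?thesis unfolding isCont_def by (rule tendsto_position)
next
  case (impact f)
  then have "((\<lambda>t. position (g t)) \<longlongrightarrow> position (g t)) (at_left t)"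
    using tendsto_position[OF impact(3)] by auto
  moreover have "((\<lambda>t. position (g t)) \<longlongrightarrow> position (g t)) (at_right t)"
    using tendsto_position[OF impact(4)] .
  ultimately show ?thesis unfolding isCont_def by (rule filterlim_split_at)
qed

lemma impact_motion_interior:
  assumes "impact_motion V1 V2 P J g" "t \<in> J" "position (g t) \<in> interior P"
  shows "(g has_vector_derivative hamilton_field V1 V2 (g t)) (at t)"
  using assms by (simp add: impact_motion_def)

text \<open>If \<open>s\<close> is only the left limit at time 0, continuity of positions puts
  \<open>g 0\<close> over the same interior point. There \<open>g\<close> itself is continuous, so
  the left limit is \<open>g 0\<close>.\<close>

lemma impact_orbit_initial:
  assumes orbit: "impact_orbit V1 V2 P s J g" and s: "position s \<in> interior P"
  shows "g 0 = s"
proof (rule ccontr)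
  assume ne: "g 0 \<noteq> s"
  have m: "impact_motion V1 V2 P J g" and lim: "(g \<longlongrightarrow> s) (at_left 0)"
    using orbit ne by (auto simp: impact_orbit_def)
  then have 0: "0 \<in> J" by (simp add: impact_motion_def)
  have "((\<lambda>t. position (g t)) \<longlongrightarrow> position (g 0)) (at_left 0)"
    using impact_motion_position_continuous[OF m 0]
    by (simp add: isCont_def filterlim_at_split)
  with tendsto_position[OF lim] have "position s = position (g 0)"
    by (intro tendsto_unique[of "at_left (0::real)"]) auto
  with s m 0 have "(g has_vector_derivative hamilton_field V1 V2 (g 0)) (at 0)"
    by (intro impact_motion_interior) auto
  then have "isCont g 0" by (rule has_vector_derivative_continuous)
  then have "(g \<longlongrightarrow> g 0) (at_left 0)" by (simp add: isCont_def filterlim_at_split)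
  with lim have "s = g 0" by (intro tendsto_unique[of "at_left (0::real)"]) auto
  with ne show False by simp
qed

text \<open>The frontier is never met, so the set of impact times is empty and the reflection
  clauses are vacuous.\<close>

lemma harmonic_impact_motion:
  assumes "\<omega>1 \<noteq> 0" "\<omega>2 \<noteq> 0"
    and int: "\<And>t. position (harmonic_motion \<omega>1 \<omega>2 s t) \<in> interior P"
  shows "impact_motion (\<lambda>x. 1 / 2 * \<omega>1\<^sup>2 * x\<^sup>2) (\<lambda>y. 1 / 2 * \<omega>2\<^sup>2 * y\<^sup>2) P UNIV
    (harmonic_motion \<omega>1 \<omega>2 s)"
proof -
  have "position (harmonic_motion \<omega>1 \<omega>2 s t) \<in> P"
    and "position (harmonic_motion \<omega>1 \<omega>2 s t) \<notin> frontier P" for t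
    using int[of t] interior_subset by (auto simp: frontier_def)
  then show ?thesis
    using harmonic_motion_derivative[OF assms(1,2)]
    by (auto simp: impact_motion_def corners_def vertical_side_def horizontal_side_def)
qed

text \<open>The set \<open>A\<close> of times of agreement and its complement in the interval
  \<open>J\<close> are both open, and \<open>A\<close> contains 0.\<close>

lemma impact_motion_eq_harmonic_motion:
  fixes \<omega>1 \<omega>2 :: real
  defines "V1 \<equiv> \<lambda>x. 1 / 2 * \<omega>1\<^sup>2 * x\<^sup>2" and "V2 \<equiv> \<lambda>y. 1 / 2 * \<omega>2\<^sup>2 * y\<^sup>2"
  assumes w: "\<omega>1 \<noteq> 0" "\<omega>2 \<noteq> 0"
    and int: "\<And>t. position (harmonic_motion \<omega>1 \<omega>2 s t) \<in> interior P"
    and m: "impact_motion V1 V2 P J g" and g0: "g 0 = s" and t: "t \<in> J"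
  shows "g t = harmonic_motion \<omega>1 \<omega>2 s t"
proof -
  define h where "h = harmonic_motion \<omega>1 \<omega>2 s"
  define A where "A = {t \<in> J. g t = h t}"
  have J: "open J" "connected J" "0 \<in> J"
    using m by (auto simp: impact_motion_def is_interval_connected)
  have h: "(h has_vector_derivative hamilton_field V1 V2 (h t)) (at t)" for t
    unfolding h_def V1_def V2_def by (rule harmonic_motion_derivative[OF w])
  have hc: "isCont h t" for t by (rule has_vector_derivative_continuous[OF h])
  have "open A"
    unfolding open_contains_ball
  proof
    fix t assume "t \<in> A"
    then have t: "t \<in> J" "g t = h t" by (auto simp: A_def)
    \<comment> \<open>Continuity of positions keeps \<open>g\<close> over the interior for nearby
      times, where it solves the same differential equation as \<open>h\<close>.\<close>
    then have "position (g t) \<in> interior P" using int by (simp add: h_def)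
    moreover from this have "\<forall>\<^sub>F r in at t. position (g r) \<in> interior P"
      using impact_motion_position_continuous[OF m t(1)]
      by (intro topological_tendstoD) (auto simp: isCont_def)
    ultimately have "\<forall>\<^sub>F r in nhds t. position (g r) \<in> interior P"
      by (simp add: eventually_nhds_conv_at)
    moreover have "\<forall>\<^sub>F r in nhds t. r \<in> J" using J(1) t(1) by (rule eventually_nhds_in_open)
    ultimately have "\<forall>\<^sub>F r in nhds t. r \<in> J \<and> position (g r) \<in> interior P"
      by eventually_elim simp
    then obtain e where e: "e > 0" "\<And>r. r \<in> ball t e \<Longrightarrow> r \<in> J \<and> position (g r) \<in> interior P"
      unfolding eventually_nhds_metric by (auto simp: dist_commute)
    have "g r = h r" if "r \<in> ball t e" for r
    proof (rule harmonic_field_unique[of "ball t e" \<omega>1 \<omega>2 g h t])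
      fix r assume "r \<in> ball t e"
      then show "(g has_vector_derivative harmonic_field \<omega>1 \<omega>2 (g r)) (at r)"
        using impact_motion_interior[OF m] e(2) unfolding V1_def V2_def by blast
      show "(h has_vector_derivative harmonic_field \<omega>1 \<omega>2 (h r)) (at r)"
        using h unfolding V1_def V2_def .
    qed (use e t w that in auto)
    with e show "\<exists>e>0. ball t e \<subseteq> A" by (auto simp: A_def)
  qed
  moreover have "open (J - A)"
    unfolding open_contains_ball
  proof
    fix t assume "t \<in> J - A"
    then have t: "t \<in> J" "g t \<noteq> h t" by (auto simp: A_def)
    have pc: "isCont (\<lambda>t. position (g t)) t" by (rule impact_motion_position_continuous[OF m t(1)])
    have phc: "isCont (\<lambda>t. position (h t)) t"
      using hc[of t] unfolding isCont_def by (rule tendsto_position)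
    \<comment> \<open>At a time of disagreement \<open>g\<close> may jump. If the positions agree,
      they are interior, so \<open>g\<close> is continuous and the states stay different. Otherwise
      the positions, continuous even across impacts, stay different.\<close>
    have "\<forall>\<^sub>F r in at t. g r \<noteq> h r"
    proof (cases "position (g t) = position (h t)")
      case True
      then have "position (g t) \<in> interior P" using int by (simp add: h_def)
      then have "isCont g t"
        by (intro has_vector_derivative_continuous[OF impact_motion_interior[OF m t(1)]])
      then have "((\<lambda>t. g t - h t) \<longlongrightarrow> g t - h t) (at t)"
        using hc[of t] unfolding isCont_def by (intro tendsto_intros)
      then have "\<forall>\<^sub>F r in at t. g r - h r \<noteq> 0"
        using t(2) by (intro tendsto_imp_eventually_ne) auto
      then show ?thesis by eventually_elim auto
    next
      case False
      have "((\<lambda>t. position (g t) - position (h t)) \<longlongrightarrow> position (g t) - position (h t)) (at t)"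
        using pc phc unfolding isCont_def by (intro tendsto_intros)
      then have "\<forall>\<^sub>F r in at t. position (g r) - position (h r) \<noteq> 0"
        using False by (intro tendsto_imp_eventually_ne) auto
      then show ?thesis by eventually_elim auto
    qed
    then have "\<forall>\<^sub>F r in nhds t. g r \<noteq> h r" using t(2) by (auto simp: eventually_nhds_conv_at)
    moreover have "\<forall>\<^sub>F r in nhds t. r \<in> J" using J(1) t(1) by (rule eventually_nhds_in_open)
    ultimately have "\<forall>\<^sub>F r in nhds t. r \<in> J - A"
      by eventually_elim (simp add: A_def)
    then show "\<exists>e>0. ball t e \<subseteq> J - A"
      unfolding eventually_nhds_metric by (force simp: dist_commute)
  qed
  moreover have "0 \<in> A" using J g0 by (simp add: A_def h_def)
  ultimately have "J - A = {}"
    using connectedD[OF J(2), of A "J - A"] J(3) by (auto simp: A_def)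
  then show ?thesis using t by (auto simp: A_def h_def)
qed

theorem proposition1p5:
  fixes \<omega>1 \<omega>2 E E1 :: real
    and V1 V2 :: "real \<Rightarrow> real"
    and P :: "(real \<times> real) set"
    and d :: "sign \<Rightarrow> sign \<Rightarrow> (real \<times> real) list"
    and I :: "real set"
  assumes "\<omega>1 > 0" and "\<omega>2 > 0" and "\<omega>1 / \<omega>2 \<in> \<rat>"
    and "V1 = (\<lambda>x. 1 / 2 * \<omega>1\<^sup>2 * x\<^sup>2)"
    and "V2 = (\<lambda>y. 1 / 2 * \<omega>2\<^sup>2 * y\<^sup>2)"
    and "has_numerical_data P d"
    and "E > 0"
    and "I \<in> energy_partition V1 V2 d E"
    and "\<exists>l :: sign \<Rightarrow> sign \<Rightarrow> nat.
           (\<forall>s1 s2. l s1 s2 < length (d s1 s2)) \<and>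
           I \<subseteq> (\<Inter>s1. \<Inter>s2. {E - V2 (snd (d s1 s2 ! l s1 s2)) .. V1 (fst (d s1 s2 ! l s1 s2))})"
    and "E1 \<in> I"
  shows "completely_periodic V1 V2 P E E1"
proof -
  have w: "\<omega>1 \<noteq> 0" "\<omega>2 \<noteq> 0" using assms(1,2) by auto
  obtain l :: "sign \<Rightarrow> sign \<Rightarrow> nat" where l: "\<And>s1 s2. l s1 s2 < length (d s1 s2)"
    and Il: "I \<subseteq> (\<Inter>s1. \<Inter>s2. {E - V2 (snd (d s1 s2 ! l s1 s2)) .. V1 (fst (d s1 s2 ! l s1 s2))})"
    using assms(9) by blast
  define X Y where "X s1 s2 = fst (d s1 s2 ! l s1 s2)" and "Y s1 s2 = snd (d s1 s2 ! l s1 s2)" for s1 s2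
  have XY: "(X s1 s2, Y s1 s2) \<in> set (d s1 s2)" for s1 s2
    using l by (simp add: X_def Y_def)
  have pos: "X s1 s2 > 0" "Y s1 s2 > 0" for s1 s2
    using XY[of s1 s2] assms(6) by (fastforce simp: has_numerical_data_def Xi_def)+
  \<comment> \<open>\<open>E1\<close> is none of the numbers defining the partition, so the bounds
    from the closed intervals become strict.\<close>
  have part: "E1 \<notin> (\<Union>s1. \<Union>s2. \<Union>(x, y) \<in> set (d s1 s2). {V1 x, E - V2 y})"
    using assms(8,10) in_components_subset unfolding energy_partition_def by blast
  have "E1 \<noteq> V1 (X s1 s2)" "E1 \<noteq> E - V2 (Y s1 s2)" for s1 s2
    using part XY[of s1 s2] by blast+
  moreover have "E1 \<le> V1 (X s1 s2)" "E - V2 (Y s1 s2) \<le> E1" for s1 s2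
    using Il assms(10) by (auto simp: X_def Y_def)
  ultimately have less: "E1 < V1 (X s1 s2)" "E - E1 < V2 (Y s1 s2)" for s1 s2
    by (smt (verit))+
  have periodic: "(\<exists>J g. impact_orbit V1 V2 P s J g) \<and>
      (\<forall>J g. impact_orbit V1 V2 P s J g \<longrightarrow> J = UNIV \<and> (\<exists>T>0. \<forall>t. g (t + T) = g t))"
    if s: "s \<in> level_set V1 V2 P E E1" for s
  proof -
    define h where "h = harmonic_motion \<omega>1 \<omega>2 s"
    have int: "position (h t) \<in> interior P" for t
    proof -
      obtain px x py y where s_eq: "s = (px, x, py, y)" by (metis prod_cases4)
      obtain px' x' py' y' where ht: "h t = (px', x', py', y')" by (metis prod_cases4)
      have "px'\<^sup>2 / 2 + V1 x' = E1" "py'\<^sup>2 / 2 + V2 y' = E - E1"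
        using s harmonic_motion_level_set[OF w ht[unfolded h_def s_eq]]
        by (simp_all add: s_eq level_set_def assms(4,5))
      \<comment> \<open>Kinetic energy is nonnegative, so the potentials are at most
        \<open>E1\<close> and \<open>E - E1\<close>.\<close>
      then have "V1 x' < V1 (X s1 s2)" "V2 y' < V2 (Y s1 s2)" for s1 s2
        using less[of s1 s2] zero_le_power2[of px'] zero_le_power2[of py'] by linarith+
      then have "x'\<^sup>2 < (X s1 s2)\<^sup>2" "y'\<^sup>2 < (Y s1 s2)\<^sup>2" for s1 s2
        using w by (auto simp: assms(4,5))
      then have "\<bar>x'\<bar> < X s1 s2 \<and> \<bar>y'\<bar> < Y s1 s2" for s1 s2
        using pos[of s1 s2]
          power2_less_imp_less[of "\<bar>x'\<bar>" "X s1 s2"] power2_less_imp_less[of "\<bar>y'\<bar>" "Y s1 s2"] by simp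
      then show ?thesis
        using in_interior_polygon[OF assms(6) XY] by (simp add: ht)
    qed
    have motion: "impact_motion V1 V2 P UNIV h"
      using harmonic_impact_motion[OF w int[unfolded h_def]] by (simp add: h_def assms(4,5))
    \<comment> \<open>Maximality is automatic for a motion defined at all times.\<close>
    then have "impact_orbit V1 V2 P s UNIV h"
      by (auto simp: impact_orbit_def h_def)
    moreover have "J = UNIV \<and> (\<exists>T>0. \<forall>t. g (t + T) = g t)" if orbit: "impact_orbit V1 V2 P s J g" for J g
    proof -
      have "g 0 = s"
        using impact_orbit_initial[OF orbit] int[of 0] by (simp add: h_def)
      then have eq: "g t = h t" if "t \<in> J" for t
        using impact_motion_eq_harmonic_motion[OF w int[unfolded h_def], folded assms(4,5), of J g t]
          orbit that by (simp add: impact_orbit_def h_def)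
      \<comment> \<open>Since \<open>g\<close> agrees with \<open>h\<close> on \<open>J\<close>, the
        motion \<open>h\<close> continues \<open>g\<close> to all times, and maximality of the orbit
        applies.\<close>
      then have J: "J = UNIV"
        using orbit motion unfolding impact_orbit_def by (metis subset_UNIV)
      then have "g = h" using eq by auto
      then show ?thesis using J harmonic_motion_periodic[OF assms(1-3)] by (simp add: h_def)
    qed
    ultimately show ?thesis by blast
  qed
  then show ?thesis unfolding completely_periodic_def by blast
qed

end
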